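(* There exists a numerical constant $c>0$ such that the following holds. Let $K\ge2$, $m\ge2$, $p=mK$, $\tau>0$, and let $\mathcal{G}$ be the set of partitions of $[p]$ into $K$ groups each of size $m$. For $G\in\mathcal{G}$ let $\Sigma_G=\tau A_GA_G^t+I_p$, where $(A_G)_{ak}=1_{\{a\in G_k\}}$ (so $\Delta(C)=2\tau$ with $C=\tau I_K$). If $$2\tau\le c\Big[\sqrt{\tfrac{\log p}{n(m-1)}}\ \vee\ \tfrac{\log p}{n}\Big],$$ then $$\inf_{\widehat G}\ \sup_{G\in\mathcal{G}}\ \mathbb{P}_{\Sigma_G}\big[\widehat G\neq G\big]\ \ge\ \frac17,$$ where the infimum is over all estimators $\widehat G$ (measurable functions of $n$ i.i.d. observations with values in partitions of $[p]$) and $\mathbb{P}_{\Sigma_G}$ is the law of $n$ i.i.d. $N(0,\Sigma_G)$ vectors. *)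

theory Defs
  imports "HOL-Probability.Probability"
begin

definition std_normal :: "real measure" where
  "std_normal = density lborel (\<lambda>x. ennreal (std_normal_density x))"

definition vec_space :: "nat \<Rightarrow> (nat \<Rightarrow> real) measure" where
  "vec_space p = PiM {..<p} (\<lambda>_. lborel)"

text \<open>Centered Gaussian law N(0,Sigma) on R^p (Sigma a symmetric positive semidefinite
  p x p matrix given as a function on indices < p): the law of B z, where z has i.i.d.
  standard normal coordinates and B is a matrix with B B^t = Sigma.\<close>
definition gauss_law :: "nat \<Rightarrow> (nat \<Rightarrow> nat \<Rightarrow> real) \<Rightarrow> (nat \<Rightarrow> real) measure" where
  "gauss_law p S =
     (let B = (SOME B :: nat \<Rightarrow> nat \<Rightarrow> real.
                 \<forall>a<p. \<forall>b<p. (\<Sum>j<p. B a j * B b j) = S a b)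
      in distr (PiM {..<p} (\<lambda>_. std_normal)) (vec_space p)
               (\<lambda>z. \<lambda>a\<in>{..<p}. \<Sum>j<p. B a j * z j))"

definition sample_law :: "nat \<Rightarrow> nat \<Rightarrow> (nat \<Rightarrow> nat \<Rightarrow> real) \<Rightarrow> (nat \<Rightarrow> nat \<Rightarrow> real) measure" where
  "sample_law n p S = PiM {..<n} (\<lambda>_. gauss_law p S)"

definition balanced_partitions :: "nat \<Rightarrow> nat \<Rightarrow> nat \<Rightarrow> nat set set set" where
  "balanced_partitions p K m =
     {G. partition_on {..<p} G \<and> card G = K \<and> (\<forall>g\<in>G. card g = m)}"

text \<open>Sigma_G = tau A_G A_G^t + I_p, with (A_G A_G^t)_{ab} = sum over groups g of 1{a in g} 1{b in g}.\<close>
definition Sigma_G :: "real \<Rightarrow> nat set set \<Rightarrow> nat \<Rightarrow> nat \<Rightarrow> real" where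
  "Sigma_G tau G a b =
     tau * (\<Sum>g\<in>G. indicator g a * indicator g b) + (if a = b then 1 else 0)"

definition estimators :: "nat \<Rightarrow> nat \<Rightarrow> ((nat \<Rightarrow> nat \<Rightarrow> real) \<Rightarrow> nat set set) set" where
  "estimators n p =
     {Gh. Gh \<in> measurable (PiM {..<n} (\<lambda>_. vec_space p)) (count_space UNIV) \<and>
          (\<forall>x\<in>space (PiM {..<n} (\<lambda>_. vec_space p)). partition_on {..<p} (Gh x))}"

end

theory Submission
  imports Defs
begin

text \<open>Fix a balanced partition and compare it with the \<open>p - m \<ge> p / 2\<close> partitions obtained by
  exchanging the element \<open>0\<close> with an element \<open>b\<close> of another group. If every error probability were below
  \<open>1/7\<close>, each alternative law would give its own event probability above \<open>6/7\<close>, while the reference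
  law gives one of these disjoint events probability at most \<open>2/p\<close>. The variational bound for the
  Kullback-Leibler divergence turns this into a lower bound of order \<open>log p\<close> on the divergence between
  the two samples. But that divergence is at most \<open>n \<tau>\<^sup>2 \<parallel>M' - M\<parallel>\<^sup>2 / (2 (1 + m \<tau>))\<close>, with \<open>M\<close>, \<open>M'\<close>
  the membership matrices, and \<open>\<parallel>M' - M\<parallel>\<^sup>2 \<le> 8 m\<close> because an exchange alters two rows and two columns.\<close>

subsection \<open>Lebesgue measure on a product and linear maps\<close>

text \<open>Two measures on a finite product agree once they agree on boxes. There the indicator
  splits into coordinate indicators, and Tonelli turns the integral of the product density into a
  product of one-dimensional integrals.\<close>

lemma PiM_density:
  assumes I: "finite I" and N: "sigma_finite_measure N" and D: "sigma_finite_measure (density N f)"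
    and f[measurable]: "f \<in> borel_measurable N"
  shows "PiM I (\<lambda>_. density N f) = density (PiM I (\<lambda>_. N)) (\<lambda>x. \<Prod>i\<in>I. f (x i))"
proof -
  interpret N: product_sigma_finite "\<lambda>_. N" using N by (simp add: product_sigma_finite_def)
  interpret D: product_sigma_finite "\<lambda>_. density N f" using D by (simp add: product_sigma_finite_def)
  have "density (PiM I (\<lambda>_. N)) (\<lambda>x. \<Prod>i\<in>I. f (x i)) = PiM I (\<lambda>_. density N f)"
  proof (rule D.PiM_eqI[OF I])
    show "sets (density (PiM I (\<lambda>_. N)) (\<lambda>x. \<Prod>i\<in>I. f (x i))) = sets (PiM I (\<lambda>_. density N f))"
      by (simp cong: sets_PiM_cong)
    fix A assume "\<And>i. i \<in> I \<Longrightarrow> A i \<in> sets (density N f)"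
    then have A: "\<And>i. i \<in> I \<Longrightarrow> A i \<in> sets N" by simp
    have "emeasure (density (PiM I (\<lambda>_. N)) (\<lambda>x. \<Prod>i\<in>I. f (x i))) (Pi\<^sub>E I A)
        = (\<integral>\<^sup>+x. (\<Prod>i\<in>I. f (x i)) * indicator (Pi\<^sub>E I A) x \<partial>PiM I (\<lambda>_. N))"
      using A I by (intro emeasure_density sets_PiM_I_finite) auto
    also have "\<dots> = (\<integral>\<^sup>+x. (\<Prod>i\<in>I. f (x i) * indicator (A i) (x i)) \<partial>PiM I (\<lambda>_. N))"
    proof (intro nn_integral_cong)
      fix x assume "x \<in> space (PiM I (\<lambda>_. N))"
      \<comment> \<open>Points of the product space are extensional, so only the coordinate
        conditions remain in membership of the box.\<close>
      then have "x \<in> extensional I" by (auto simp: space_PiM PiE_def)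
      then have "indicator (Pi\<^sub>E I A) x = (\<Prod>i\<in>I. indicator (A i) (x i) :: ennreal)"
        using I by (auto simp: indicator_def PiE_def Pi_def split: if_splits)
      then show "(\<Prod>i\<in>I. f (x i)) * indicator (Pi\<^sub>E I A) x = (\<Prod>i\<in>I. f (x i) * indicator (A i) (x i))"
        by (simp add: prod.distrib)
    qed
    also have "\<dots> = (\<Prod>i\<in>I. \<integral>\<^sup>+x. f x * indicator (A i) x \<partial>N)"
      using A I by (intro N.product_nn_integral_prod) auto
    also have "\<dots> = (\<Prod>i\<in>I. emeasure (density N f) (A i))"
      using A by (intro prod.cong) (auto simp: emeasure_density)
    finally show "emeasure (density (PiM I (\<lambda>_. N)) (\<lambda>x. \<Prod>i\<in>I. f (x i))) (Pi\<^sub>E I A)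
        = (\<Prod>i\<in>I. emeasure (density N f) (A i))" .
  qed
  then show ?thesis ..
qed

interpretation lborel_prod: product_sigma_finite "\<lambda>_::nat. lborel :: real measure"
  by (simp add: product_sigma_finite_def sigma_finite_lborel)

lemma sigma_finite_vec_space: "sigma_finite_measure (vec_space p)"
  unfolding vec_space_def by (rule lborel_prod.sigma_finite) simp

lemma space_vec_space: "space (vec_space p) = extensional {..<p}"
  by (simp add: vec_space_def space_PiM PiE_def)

lemma measurable_vec_space_component[measurable]:
  "a < p \<Longrightarrow> (\<lambda>x. x a) \<in> borel_measurable (vec_space p)"
  unfolding vec_space_def by measurable

lemma measurable_vec_space_restrict:
  assumes "\<And>a. a < p \<Longrightarrow> (\<lambda>x. f x a) \<in> borel_measurable M"
  shows "(\<lambda>x. \<lambda>a\<in>{..<p}. f x a) \<in> measurable M (vec_space p)"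
  unfolding vec_space_def using assms by (intro measurable_restrict) auto

text \<open>The preimage of a box under a translation is a box with translated sides, and each side
  keeps its one-dimensional Lebesgue measure.\<close>

lemma nn_integral_vec_space_translate:
  assumes f[measurable]: "f \<in> borel_measurable (vec_space p)"
  shows "(\<integral>\<^sup>+x. f (\<lambda>a\<in>{..<p}. x a + v a) \<partial>vec_space p) = (\<integral>\<^sup>+x. f x \<partial>vec_space p)"
proof -
  let ?t = "\<lambda>x. \<lambda>a\<in>{..<p}. x a + v a :: real"
  have [measurable]: "?t \<in> measurable (vec_space p) (vec_space p)"
    by (rule measurable_vec_space_restrict) simp
  have "distr (vec_space p) (vec_space p) ?t = PiM {..<p} (\<lambda>_. lborel)"
  proof (rule lborel_prod.PiM_eqI)
    fix A :: "nat \<Rightarrow> real set" assume A: "\<And>i. i \<in> {..<p} \<Longrightarrow> A i \<in> sets lborel"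
    have "emeasure (distr (vec_space p) (vec_space p) ?t) (Pi\<^sub>E {..<p} A)
       = emeasure (vec_space p) (?t -` Pi\<^sub>E {..<p} A \<inter> space (vec_space p))"
      using A by (intro emeasure_distr) (auto simp: vec_space_def intro!: sets_PiM_I_finite)
    also have "?t -` Pi\<^sub>E {..<p} A \<inter> space (vec_space p) = Pi\<^sub>E {..<p} (\<lambda>i. (\<lambda>y. v i + y) -` A i)"
      by (auto simp: space_vec_space PiE_def Pi_def add.commute split: if_splits)
    also have "emeasure (vec_space p) \<dots> = (\<Prod>i<p. emeasure lborel ((\<lambda>y. v i + y) -` A i))"
    proof -
      have "(\<lambda>y. v i + y) -` A i \<in> sets lborel" if "i < p" for i
        using measurable_sets[of "\<lambda>y. v i + y" borel borel "A i"] A[of i] that by simp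
      then show ?thesis unfolding vec_space_def by (intro lborel_prod.emeasure_PiM) auto
    qed
    also have "\<dots> = (\<Prod>i<p. emeasure lborel (A i))"
    proof (intro prod.cong refl)
      fix i assume "i \<in> {..<p}"
      then have Ai: "A i \<in> sets borel" using A by simp
      have "emeasure lborel (A i) = emeasure (distr lborel borel ((+) (v i))) (A i)"
        by (simp only: lborel_distr_plus)
      also have "\<dots> = emeasure lborel ((\<lambda>y. v i + y) -` A i)"
        using Ai by (simp add: emeasure_distr)
      finally show "emeasure lborel ((\<lambda>y. v i + y) -` A i) = emeasure lborel (A i)" ..
    qed
    finally show "emeasure (distr (vec_space p) (vec_space p) ?t) (Pi\<^sub>E {..<p} A)
      = (\<Prod>i<p. emeasure lborel (A i))" .
  qed (auto simp: vec_space_def)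
  then have "distr (vec_space p) (vec_space p) ?t = vec_space p" by (simp add: vec_space_def)
  then have "(\<integral>\<^sup>+x. f x \<partial>vec_space p) = (\<integral>\<^sup>+x. f x \<partial>distr (vec_space p) (vec_space p) ?t)" by simp
  also have "\<dots> = (\<integral>\<^sup>+x. f (?t x) \<partial>vec_space p)" by (rule nn_integral_distr) simp_all
  finally show ?thesis ..
qed

definition lin_map :: "nat \<Rightarrow> (nat \<Rightarrow> nat \<Rightarrow> real) \<Rightarrow> (nat \<Rightarrow> real) \<Rightarrow> nat \<Rightarrow> real" where
  "lin_map p B z = (\<lambda>a\<in>{..<p}. \<Sum>j<p. B a j * z j)"

lemma measurable_lin_map[measurable]: "lin_map p B \<in> measurable (vec_space p) (vec_space p)"
  unfolding lin_map_def by (rule measurable_vec_space_restrict) measurable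

text \<open>\<open>B (z + U x) = B z + B U x\<close>, and \<open>B U\<close> is the identity. Any
  translation of the target can thus be produced by one of the source.\<close>

lemma lin_map_right_inverse_shift:
  assumes BU: "\<And>a b. a < p \<Longrightarrow> b < p \<Longrightarrow> (\<Sum>j<p. B a j * U j b) = (if a = b then 1 else 0)"
  shows "lin_map p B (\<lambda>a\<in>{..<p}. z a + lin_map p U x a) = (\<lambda>a\<in>{..<p}. lin_map p B z a + x a)"
proof -
  have "(\<Sum>j<p. B a j * (\<Sum>b<p. U j b * x b)) = x a" if "a < p" for a
  proof -
    have "(\<Sum>j<p. B a j * (\<Sum>b<p. U j b * x b)) = (\<Sum>b<p. (\<Sum>j<p. B a j * U j b) * x b)"
      by (simp add: sum_distrib_left sum_distrib_right mult.assoc) (rule sum.swap)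
    also have "\<dots> = (\<Sum>b<p. if a = b then x b else 0)"
      using that by (intro sum.cong) (auto simp: BU)
    finally show ?thesis using that by simp
  qed
  then show ?thesis
    by (auto simp: lin_map_def fun_eq_iff distrib_left sum.distrib)
qed

text \<open>Both sides equal the double integral of \<open>F (T z) h (x - T z)\<close>, where \<open>T\<close> is the linear map;
  this determines the image of Lebesgue measure under \<open>T\<close> up to a constant, without determinants.\<close>
lemma nn_integral_lin_map_cross:
  assumes BU: "\<And>a b. a < p \<Longrightarrow> b < p \<Longrightarrow> (\<Sum>j<p. B a j * U j b) = (if a = b then 1 else 0)"
    and F[measurable]: "F \<in> borel_measurable (vec_space p)"
    and h[measurable]: "h \<in> borel_measurable (vec_space p)"
    and even: "\<And>x. h (\<lambda>a\<in>{..<p}. - x a) = h x"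
  shows "(\<integral>\<^sup>+z. F (lin_map p B z) \<partial>vec_space p) * (\<integral>\<^sup>+x. h x \<partial>vec_space p)
       = (\<integral>\<^sup>+x. F x \<partial>vec_space p) * (\<integral>\<^sup>+z. h (lin_map p B z) \<partial>vec_space p)"
proof -
  let ?L = "vec_space p" and ?T = "lin_map p B"
  interpret pair_sigma_finite ?L ?L
    by (intro pair_sigma_finite.intro sigma_finite_vec_space)
  have cmp: "(\<lambda>w. f w a) \<in> borel_measurable M" if "f \<in> measurable M ?L" "a < p" for f a and M :: "'m measure"
    using measurable_compose[OF that(1) measurable_vec_space_component[OF that(2)]] .
  have [measurable]: "(\<lambda>w. \<lambda>a\<in>{..<p}. snd w a + - ?T (fst w) a) \<in> measurable (?L \<Otimes>\<^sub>M ?L) ?L"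
    by (intro measurable_vec_space_restrict borel_measurable_add borel_measurable_uminus cmp) measurable
  have [measurable]: "(\<lambda>w. \<lambda>a\<in>{..<p}. ?T (fst w) a + snd w a) \<in> measurable (?L \<Otimes>\<^sub>M ?L) ?L"
    by (intro measurable_vec_space_restrict borel_measurable_add borel_measurable_uminus cmp) measurable
  have m1: "(\<lambda>(z, x). F (?T z) * h (\<lambda>a\<in>{..<p}. x a + - ?T z a)) \<in> borel_measurable (?L \<Otimes>\<^sub>M ?L)"
    unfolding split_beta by measurable
  have m2: "(\<lambda>(z, x). F (\<lambda>a\<in>{..<p}. ?T z a + x a) * h (?T z)) \<in> borel_measurable (?L \<Otimes>\<^sub>M ?L)"
    unfolding split_beta by measurable
  have "(\<integral>\<^sup>+z. F (?T z) \<partial>?L) * (\<integral>\<^sup>+x. h x \<partial>?L) = (\<integral>\<^sup>+z. F (?T z) * (\<integral>\<^sup>+x. h x \<partial>?L) \<partial>?L)"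
    by (simp add: nn_integral_multc)
  also have "\<dots> = (\<integral>\<^sup>+z. \<integral>\<^sup>+x. F (?T z) * h (\<lambda>a\<in>{..<p}. x a + - ?T z a) \<partial>?L \<partial>?L)"
  proof (intro nn_integral_cong)
    fix z assume [measurable]: "z \<in> space ?L"
    have [measurable]: "(\<lambda>x. \<lambda>a\<in>{..<p}. x a + - ?T z a) \<in> measurable ?L ?L"
      by (rule measurable_vec_space_restrict) measurable
    show "F (?T z) * (\<integral>\<^sup>+x. h x \<partial>?L) = (\<integral>\<^sup>+x. F (?T z) * h (\<lambda>a\<in>{..<p}. x a + - ?T z a) \<partial>?L)"
      by (subst nn_integral_vec_space_translate[symmetric, of h p "\<lambda>a. - ?T z a"])
         (simp_all add: nn_integral_cmult del: add_uminus_conv_diff)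
  qed
  also have "\<dots> = (\<integral>\<^sup>+x. \<integral>\<^sup>+z. F (?T z) * h (\<lambda>a\<in>{..<p}. x a + - ?T z a) \<partial>?L \<partial>?L)"
    using Fubini'[OF m1] by simp
  \<comment> \<open>Substituting \<open>z + U x\<close> for \<open>z\<close> turns
    \<open>T z\<close> into \<open>T z + x\<close> and \<open>x - T z\<close> into
    \<open>- T z\<close>; evenness of \<open>h\<close> removes the sign.\<close>
  also have "\<dots> = (\<integral>\<^sup>+x. \<integral>\<^sup>+z. F (\<lambda>a\<in>{..<p}. ?T z a + x a) * h (?T z) \<partial>?L \<partial>?L)"
  proof (rule nn_integral_cong)
    fix x assume x: "x \<in> space ?L"
    have m3: "(\<lambda>z. F (?T z) * h (\<lambda>a\<in>{..<p}. x a + - ?T z a)) \<in> borel_measurable ?L"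
      using measurable_compose[OF measurable_Pair2'[OF x, of ?L] m1] by simp
    have eq: "h (\<lambda>a\<in>{..<p}. x a + - (\<lambda>a\<in>{..<p}. ?T z a + x a) a) = h (?T z)" for z
    proof -
      have "(\<lambda>a\<in>{..<p}. x a + - (\<lambda>a\<in>{..<p}. ?T z a + x a) a) = (\<lambda>a\<in>{..<p}. - ?T z a)"
        by (auto simp: fun_eq_iff)
      then show ?thesis by (simp only: even)
    qed
    have "(\<integral>\<^sup>+z. F (?T z) * h (\<lambda>a\<in>{..<p}. x a + - ?T z a) \<partial>?L)
        = (\<integral>\<^sup>+z. F (?T (\<lambda>a\<in>{..<p}. z a + lin_map p U x a))
            * h (\<lambda>a\<in>{..<p}. x a + - ?T (\<lambda>a\<in>{..<p}. z a + lin_map p U x a) a) \<partial>?L)"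
      using nn_integral_vec_space_translate[OF m3, of "lin_map p U x"] by (rule sym)
    also have "\<dots> = (\<integral>\<^sup>+z. F (\<lambda>a\<in>{..<p}. ?T z a + x a) * h (?T z) \<partial>?L)"
      by (simp only: lin_map_right_inverse_shift[OF BU] eq)
    finally show "(\<integral>\<^sup>+z. F (?T z) * h (\<lambda>a\<in>{..<p}. x a + - ?T z a) \<partial>?L)
        = (\<integral>\<^sup>+z. F (\<lambda>a\<in>{..<p}. ?T z a + x a) * h (?T z) \<partial>?L)" .
  qed
  also have "\<dots> = (\<integral>\<^sup>+z. \<integral>\<^sup>+x. F (\<lambda>a\<in>{..<p}. ?T z a + x a) * h (?T z) \<partial>?L \<partial>?L)"
    using Fubini'[OF m2] by simp
  also have "\<dots> = (\<integral>\<^sup>+z. (\<integral>\<^sup>+x. F x \<partial>?L) * h (?T z) \<partial>?L)"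
  proof (intro nn_integral_cong)
    fix z assume "z \<in> space ?L"
    have [measurable]: "(\<lambda>x. \<lambda>a\<in>{..<p}. x a + ?T z a) \<in> measurable ?L ?L"
      by (rule measurable_vec_space_restrict) measurable
    show "(\<integral>\<^sup>+x. F (\<lambda>a\<in>{..<p}. ?T z a + x a) * h (?T z) \<partial>?L) = (\<integral>\<^sup>+x. F x \<partial>?L) * h (?T z)"
      by (subst nn_integral_vec_space_translate[symmetric, of F p "\<lambda>a. ?T z a"])
         (simp_all add: nn_integral_multc add.commute)
  qed
  also have "\<dots> = (\<integral>\<^sup>+x. F x \<partial>?L) * (\<integral>\<^sup>+z. h (?T z) \<partial>?L)"
    by (simp add: nn_integral_cmult)
  finally show ?thesis .
qed

subsection \<open>Density and covariance of a centred Gaussian law\<close>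

lemma prob_space_std_normal: "prob_space std_normal"
  unfolding std_normal_def using prob_space_normal_density[of 1 0] by simp

lemma PiM_std_normal_density:
  "PiM {..<p} (\<lambda>_. std_normal) = density (vec_space p)
     (\<lambda>z. ennreal ((1 / sqrt (2 * pi)) ^ p * exp (- (\<Sum>j<p. (z j)\<^sup>2) / 2)))"
proof -
  have "(\<Prod>j<p. ennreal (std_normal_density (z j))) =
      ennreal ((1 / sqrt (2 * pi)) ^ p * exp (- (\<Sum>j<p. (z j)\<^sup>2) / 2))" for z :: "nat \<Rightarrow> real"
  proof -
    have "(\<Prod>j<p. ennreal (std_normal_density (z j))) = ennreal (\<Prod>j<p. std_normal_density (z j))"
      by (rule prod_ennreal) simp
    also have "(\<Prod>j<p. std_normal_density (z j)) = (1 / sqrt (2 * pi)) ^ p * (\<Prod>j<p. exp (- (z j)\<^sup>2 / 2))"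
      by (simp only: std_normal_density_def prod.distrib prod_constant card_lessThan)
    also have "(\<Prod>j<p. exp (- (z j)\<^sup>2 / 2)) = exp (- (\<Sum>j<p. (z j)\<^sup>2) / 2)"
      by (simp add: exp_sum sum_divide_distrib sum_negf flip: exp_sum)
    finally show ?thesis .
  qed
  moreover have "sigma_finite_measure (density lborel (\<lambda>x. ennreal (std_normal_density x)))"
    using prob_space_std_normal unfolding std_normal_def
    by (simp add: prob_space_imp_sigma_finite)
  ultimately show ?thesis
    unfolding std_normal_def vec_space_def
    by (subst PiM_density) (simp_all add: sigma_finite_lborel)
qed

section \<open>One-sided inverses and quadratic forms\<close>

text \<open>Write \<open>N\<close> for \<open>U B\<close>. From \<open>B U = I\<close> follow
  \<open>N N = U (B U) B = N\<close> and \<open>tr N = tr (B U) = p\<close>. With symmetry, the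
  squared Frobenius norm of \<open>N - I\<close> equals \<open>tr N - 2 tr N + p\<close>, which is
  zero.\<close>

lemma symmetric_right_inverse_imp_left_inverse:
  fixes B U :: "nat \<Rightarrow> nat \<Rightarrow> real"
  assumes BU: "\<And>a b. a < p \<Longrightarrow> b < p \<Longrightarrow> (\<Sum>j<p. B a j * U j b) = (if a = b then 1 else 0)"
    and sym: "\<And>i j. i < p \<Longrightarrow> j < p \<Longrightarrow> (\<Sum>a<p. U i a * B a j) = (\<Sum>a<p. U j a * B a i)"
    and ij: "i < p" "j < p"
  shows "(\<Sum>a<p. U i a * B a j) = (if i = j then 1 else 0)"
proof -
  define N where "N i j = (\<Sum>a<p. U i a * B a j)" for i j
  define d where "d i j = (if i = j then 1 else 0 :: real)" for i j :: nat
  have idem: "(\<Sum>k<p. N i k * N k j) = N i j" for i j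
  proof -
    have "(\<Sum>k<p. N i k * N k j) = (\<Sum>k<p. \<Sum>a<p. \<Sum>b<p. U i a * (B a k * U k b) * B b j)"
      unfolding N_def sum_product by (intro sum.cong refl) (simp add: mult.assoc)
    also have "\<dots> = (\<Sum>a<p. \<Sum>b<p. \<Sum>k<p. U i a * (B a k * U k b) * B b j)"
      by (subst sum.swap, rule sum.cong[OF refl], rule sum.swap)
    also have "\<dots> = (\<Sum>a<p. \<Sum>b<p. U i a * d a b * B b j)"
      by (intro sum.cong refl) (simp add: BU d_def flip: sum_distrib_left sum_distrib_right)
    also have "\<dots> = (\<Sum>a<p. \<Sum>b<p. if a = b then U i b * B b j else 0)"
      by (intro sum.cong refl) (simp add: d_def)
    also have "\<dots> = N i j" by (simp add: N_def)
    finally show ?thesis .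
  qed
  have tr: "(\<Sum>i<p. N i i) = p"
  proof -
    have "(\<Sum>i<p. N i i) = (\<Sum>a<p. \<Sum>i<p. B a i * U i a)"
      unfolding N_def by (subst sum.swap) (simp add: mult.commute)
    also have "\<dots> = p" by (simp add: BU)
    finally show ?thesis .
  qed
  have "(\<Sum>i<p. \<Sum>k<p. (N i k - d i k)\<^sup>2) = (\<Sum>i<p. \<Sum>k<p. N i k * N k i - 2 * (d i k * N i k) + d i k)"
  proof (intro sum.cong refl)
    fix i k assume "i \<in> {..<p}" "k \<in> {..<p}"
    then have "N i k = N k i" using sym by (simp add: N_def)
    then show "(N i k - d i k)\<^sup>2 = N i k * N k i - 2 * (d i k * N i k) + d i k"
      by (simp add: d_def power2_eq_square algebra_simps)
  qed
  also have "\<dots> = (\<Sum>i<p. (\<Sum>k<p. N i k * N k i) - 2 * (\<Sum>k<p. d i k * N i k) + (\<Sum>k<p. d i k))"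
    by (simp add: sum.distrib sum_subtractf sum_distrib_left)
  also have "\<dots> = (\<Sum>i<p. N i i - 2 * N i i + 1)"
  proof (intro sum.cong refl)
    fix i assume i: "i \<in> {..<p}"
    have "(\<Sum>k<p. d i k * N i k) = (\<Sum>k<p. if i = k then N i k else 0)"
      by (intro sum.cong) (auto simp: d_def)
    then show "(\<Sum>k<p. N i k * N k i) - 2 * (\<Sum>k<p. d i k * N i k) + (\<Sum>k<p. d i k) = N i i - 2 * N i i + 1"
      using i by (simp add: idem d_def)
  qed
  also have "\<dots> = 0" using tr by (simp add: sum.distrib sum_subtractf flip: sum_distrib_left)
  finally have "(\<Sum>i<p. \<Sum>k<p. (N i k - d i k)\<^sup>2) = 0" .
  then have "\<forall>i\<in>{..<p}. (\<Sum>k<p. (N i k - d i k)\<^sup>2) = 0"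
    by (subst (asm) sum_nonneg_eq_0_iff) (auto intro: sum_nonneg)
  then have "(\<Sum>k<p. (N i k - d i k)\<^sup>2) = 0" using ij by simp
  then have "N i j = d i j"
    using ij by (subst (asm) sum_nonneg_eq_0_iff) auto
  then show ?thesis by (simp add: N_def d_def)
qed

definition quad :: "nat \<Rightarrow> (nat \<Rightarrow> nat \<Rightarrow> real) \<Rightarrow> (nat \<Rightarrow> real) \<Rightarrow> real" where
  "quad p W x = (\<Sum>a<p. \<Sum>b<p. W a b * (x a * x b))"

lemma measurable_quad[measurable]: "quad p W \<in> borel_measurable (vec_space p)"
  unfolding quad_def by measurable

lemma quad_minus: "quad p W (\<lambda>a\<in>{..<p}. - x a) = quad p W x"
  by (simp add: quad_def)

text \<open>With \<open>S = B B^t\<close>, the matrix \<open>U = B^t W\<close> gives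
  \<open>B U = S W = I\<close>.\<close>

lemma factor_right_inverse:
  fixes B W S :: "nat \<Rightarrow> nat \<Rightarrow> real"
  assumes BB: "\<And>a b. a < p \<Longrightarrow> b < p \<Longrightarrow> (\<Sum>j<p. B a j * B b j) = S a b"
    and SW: "\<And>a b. a < p \<Longrightarrow> b < p \<Longrightarrow> (\<Sum>c<p. S a c * W c b) = (if a = b then 1 else 0)"
    and ab: "a < p" "b < p"
  shows "(\<Sum>j<p. B a j * (\<Sum>c<p. B c j * W c b)) = (if a = b then 1 else 0)"
proof -
  have "(\<Sum>j<p. B a j * (\<Sum>c<p. B c j * W c b)) = (\<Sum>c<p. (\<Sum>j<p. B a j * B c j) * W c b)"
    by (simp add: sum_distrib_left sum_distrib_right mult.assoc) (rule sum.swap)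
  also have "\<dots> = (\<Sum>c<p. S a c * W c b)" using ab by (intro sum.cong) (simp_all add: BB)
  finally show ?thesis using ab by (simp add: SW)
qed

text \<open>The form equals \<open>z^t (B^t W B) z\<close>. As \<open>B^t W\<close> is a right
  inverse of \<open>B\<close> and \<open>B^t W B\<close> is symmetric, \<open>B^t W B\<close> is the
  identity.\<close>

lemma quad_lin_map:
  assumes BB: "\<And>a b. a < p \<Longrightarrow> b < p \<Longrightarrow> (\<Sum>j<p. B a j * B b j) = S a b"
    and SW: "\<And>a b. a < p \<Longrightarrow> b < p \<Longrightarrow> (\<Sum>c<p. S a c * W c b) = (if a = b then 1 else 0)"
    and W: "\<And>a b. W a b = W b a"
  shows "quad p W (lin_map p B z) = (\<Sum>j<p. (z j)\<^sup>2)"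
proof -
  define U where "U j b = (\<Sum>c<p. B c j * W c b)" for j b
  have N: "(\<Sum>b<p. U i b * B b j) = (\<Sum>a<p. \<Sum>b<p. W a b * (B a i * B b j))" for i j
    unfolding U_def sum_distrib_right by (subst sum.swap) (simp add: ac_simps)
  have sym: "(\<Sum>b<p. U i b * B b j) = (\<Sum>b<p. U j b * B b i)" for i j
    unfolding N by (subst sum.swap) (simp add: W mult.commute)
  have id: "(\<Sum>b<p. U i b * B b j) = (if i = j then 1 else 0)" if "i < p" "j < p" for i j
    by (rule symmetric_right_inverse_imp_left_inverse[OF _ sym that])
       (simp add: U_def factor_right_inverse[OF BB SW])
  have "quad p W (lin_map p B z) =
      (\<Sum>a<p. \<Sum>b<p. \<Sum>i<p. \<Sum>j<p. z i * z j * (W a b * (B a i * B b j)))"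
  proof -
    have "W a b * (lin_map p B z a * lin_map p B z b)
        = (\<Sum>i<p. \<Sum>j<p. z i * z j * (W a b * (B a i * B b j)))" if "a < p" "b < p" for a b
    proof -
      have "W a b * (lin_map p B z a * lin_map p B z b)
          = (\<Sum>i<p. \<Sum>j<p. W a b * ((B a i * z i) * (B b j * z j)))"
        using that by (simp only: lin_map_def restrict_apply' lessThan_iff sum_distrib_left[of "W a b"] sum_product)
      then show ?thesis by (simp add: ac_simps)
    qed
    then show ?thesis unfolding quad_def by (intro sum.cong refl) simp
  qed
  also have "\<dots> = (\<Sum>a<p. \<Sum>i<p. \<Sum>j<p. \<Sum>b<p. z i * z j * (W a b * (B a i * B b j)))"
    by (rule sum.cong[OF refl], subst sum.swap, rule sum.cong[OF refl], rule sum.swap)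
  also have "\<dots> = (\<Sum>i<p. \<Sum>j<p. \<Sum>a<p. \<Sum>b<p. z i * z j * (W a b * (B a i * B b j)))"
    by (subst sum.swap, rule sum.cong[OF refl], rule sum.swap)
  also have "\<dots> = (\<Sum>i<p. \<Sum>j<p. z i * z j * (\<Sum>b<p. U i b * B b j))"
    by (simp add: N sum_distrib_left)
  also have "\<dots> = (\<Sum>i<p. \<Sum>j<p. if i = j then z i * z j else 0)"
    by (intro sum.cong refl) (simp add: id)
  also have "\<dots> = (\<Sum>j<p. (z j)\<^sup>2)" by (simp add: power2_eq_square)
  finally show ?thesis .
qed

text \<open>The choice operator in \<open>gauss_law\<close> returns a true factor once one is known
  to exist; later arguments use nothing of the chosen \<open>B\<close> but
  \<open>B B^t = S\<close>.\<close>

lemma gauss_law_factor: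
  assumes "\<exists>B :: nat \<Rightarrow> nat \<Rightarrow> real. \<forall>a<p. \<forall>b<p. (\<Sum>j<p. B a j * B b j) = S a b"
  obtains B :: "nat \<Rightarrow> nat \<Rightarrow> real"
  where "\<forall>a<p. \<forall>b<p. (\<Sum>j<p. B a j * B b j) = S a b"
    and "gauss_law p S = distr (PiM {..<p} (\<lambda>_. std_normal)) (vec_space p) (lin_map p B)"
proof -
  let ?B = "SOME B :: nat \<Rightarrow> nat \<Rightarrow> real. \<forall>a<p. \<forall>b<p. (\<Sum>j<p. B a j * B b j) = S a b"
  have "\<forall>a<p. \<forall>b<p. (\<Sum>j<p. ?B a j * ?B b j) = S a b" using assms by (rule someI_ex)
  moreover have "gauss_law p S = distr (PiM {..<p} (\<lambda>_. std_normal)) (vec_space p) (lin_map p ?B)"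
    unfolding gauss_law_def Let_def lin_map_def ..
  ultimately show ?thesis using that by blast
qed

lemma measurable_lin_map_std_normal:
  "lin_map p B \<in> measurable (PiM {..<p} (\<lambda>_. std_normal)) (vec_space p)"
  using measurable_lin_map[of p B] by (simp add: PiM_std_normal_density)

lemma prob_space_PiM_std_normal: "prob_space (PiM I (\<lambda>_. std_normal))"
  by (intro prob_space_PiM prob_space_std_normal)

text \<open>Apply \<open>nn_integral_lin_map_cross\<close> with \<open>h\<close> the Gaussian
  \<open>g\<close>. Its pullback under \<open>T\<close> is the standard normal density, of integral
  one, so \<open>T\<close> carries Lebesgue measure to a multiple of itself. The normalising
  constant stays implicit.\<close>

lemma gauss_law_density:
  assumes ex: "\<exists>B :: nat \<Rightarrow> nat \<Rightarrow> real. \<forall>a<p. \<forall>b<p. (\<Sum>j<p. B a j * B b j) = S a b"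
    and SW: "\<And>a b. a < p \<Longrightarrow> b < p \<Longrightarrow> (\<Sum>c<p. S a c * W c b) = (if a = b then 1 else 0)"
    and W: "\<And>a b. W a b = W b a"
  obtains c where "c > 0"
    "gauss_law p S = density (vec_space p) (\<lambda>x. ennreal (c * exp (- quad p W x / 2)))"
proof -
  obtain B where "\<forall>a<p. \<forall>b<p. (\<Sum>j<p. B a j * B b j) = S a b"
    and law: "gauss_law p S = distr (PiM {..<p} (\<lambda>_. std_normal)) (vec_space p) (lin_map p B)"
    using gauss_law_factor[OF ex] .
  then have BB: "(\<Sum>j<p. B a j * B b j) = S a b" if "a < p" "b < p" for a b
    using that by blast
  let ?L = "vec_space p" and ?T = "lin_map p B"
  define k where "k = (1 / sqrt (2 * pi)) ^ p"
  define phi :: "(nat \<Rightarrow> real) \<Rightarrow> ennreal" where "phi z = ennreal (k * exp (- (\<Sum>j<p. (z j)\<^sup>2) / 2))" for z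
  define g where "g x = ennreal (k * exp (- quad p W x / 2))" for x
  define H where "H = (\<integral>\<^sup>+x. g x \<partial>?L)"
  have k: "k > 0" by (simp add: k_def)
  have [measurable]: "phi \<in> borel_measurable ?L" "g \<in> borel_measurable ?L"
    unfolding phi_def g_def by measurable
  have std: "PiM {..<p} (\<lambda>_. std_normal) = density ?L phi"
    unfolding phi_def k_def by (rule PiM_std_normal_density)
  have gT: "g (?T z) = phi z" for z
  proof -
    have "quad p W (?T z) = (\<Sum>j<p. (z j)\<^sup>2)" by (rule quad_lin_map[OF BB SW W])
    then show ?thesis by (simp add: g_def phi_def)
  qed
  have int_phi: "(\<integral>\<^sup>+z. phi z \<partial>?L) = 1"
  proof -
    interpret prob_space "density ?L phi"
      using prob_space_PiM_std_normal[of "{..<p}"] by (simp add: std)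
    show ?thesis using emeasure_space_1 by (simp add: emeasure_density)
  qed
  have cross: "(\<integral>\<^sup>+z. F (?T z) \<partial>?L) * H = (\<integral>\<^sup>+x. F x \<partial>?L)"
    if [measurable]: "F \<in> borel_measurable ?L" for F
  proof -
    have "(\<integral>\<^sup>+z. F (?T z) \<partial>?L) * H = (\<integral>\<^sup>+x. F x \<partial>?L) * (\<integral>\<^sup>+z. g (?T z) \<partial>?L)"
      unfolding H_def
      by (rule nn_integral_lin_map_cross[OF factor_right_inverse[OF BB SW]])
         (simp_all add: g_def quad_minus)
    then show ?thesis by (simp add: gT int_phi)
  qed
  \<comment> \<open>With \<open>F = phi\<close> the product with \<open>H\<close> is one, which
    rules out both \<open>H = 0\<close> and \<open>H\<close> infinite.\<close>
  have H1: "(\<integral>\<^sup>+z. phi (?T z) \<partial>?L) * H = 1" using cross[of phi] int_phi by simp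
  then have "H \<noteq> 0" by auto
  moreover have "H \<noteq> \<top>" using H1 by (auto simp: ennreal_mult_top split: if_splits)
  ultimately obtain r where r: "H = ennreal r" "r > 0"
    by (cases H) (auto simp: less_le)
  have "gauss_law p S = density ?L (\<lambda>x. ennreal (k / r * exp (- quad p W x / 2)))"
  proof (rule measure_eqI)
    show "sets (gauss_law p S) = sets (density ?L (\<lambda>x. ennreal (k / r * exp (- quad p W x / 2))))"
      by (simp add: law)
    fix A assume "A \<in> sets (gauss_law p S)"
    then have A[measurable]: "A \<in> sets ?L" by (simp add: law)
    have "emeasure (gauss_law p S) A = emeasure (density ?L phi) (?T -` A \<inter> space ?L)"
      unfolding law std by (subst emeasure_distr) simp_all
    also have "\<dots> = (\<integral>\<^sup>+z. phi z * indicator (?T -` A \<inter> space ?L) z \<partial>?L)"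
      by (rule emeasure_density) measurable
    also have "\<dots> = (\<integral>\<^sup>+z. g (?T z) * indicator A (?T z) \<partial>?L)"
      by (intro nn_integral_cong) (auto simp: gT indicator_def)
    finally have e: "emeasure (gauss_law p S) A = (\<integral>\<^sup>+z. g (?T z) * indicator A (?T z) \<partial>?L)" .
    have "emeasure (density ?L (\<lambda>x. ennreal (k / r * exp (- quad p W x / 2)))) A
        = (\<integral>\<^sup>+x. ennreal (1 / r) * (g x * indicator A x) \<partial>?L)"
      using r k by (subst emeasure_density)
        (auto intro!: nn_integral_cong simp: g_def indicator_def divide_simps simp flip: ennreal_mult')
    also have "\<dots> = ennreal (1 / r) * (\<integral>\<^sup>+x. g x * indicator A x \<partial>?L)"
      by (rule nn_integral_cmult) measurable
    also have "\<dots> = ennreal (1 / r) * ((\<integral>\<^sup>+z. g (?T z) * indicator A (?T z) \<partial>?L) * H)"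
      by (subst cross) measurable
    also have "\<dots> = (ennreal (1 / r) * H) * emeasure (gauss_law p S) A"
      by (simp add: e ac_simps)
    also have "ennreal (1 / r) * H = 1"
      using r by (simp flip: ennreal_mult')
    finally show "emeasure (gauss_law p S) A
        = emeasure (density ?L (\<lambda>x. ennreal (k / r * exp (- quad p W x / 2)))) A" by simp
  qed
  with r k show ?thesis by (intro that[of "k / r"]) auto
qed

section \<open>Second moments\<close>

lemma std_normal_moments:
  shows "integrable std_normal (\<lambda>x. x)" "integral\<^sup>L std_normal (\<lambda>x. x) = 0"
    and "integrable std_normal (\<lambda>x. x * x)" "integral\<^sup>L std_normal (\<lambda>x. x * x) = 1"
proof -
  have 1: "has_bochner_integral lborel (\<lambda>x. std_normal_density x * x) 0"
    using std_normal_moment_odd[of 0] by simp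
  have 2: "has_bochner_integral lborel (\<lambda>x. std_normal_density x * (x * x)) 1"
    using std_normal_moment_even[of 1] by (simp add: power2_eq_square)
  show "integrable std_normal (\<lambda>x. x)" "integral\<^sup>L std_normal (\<lambda>x. x) = 0"
    unfolding std_normal_def
    using 1 by (simp_all add: integrable_real_density integral_real_density has_bochner_integral_iff)
  show "integrable std_normal (\<lambda>x. x * x)" "integral\<^sup>L std_normal (\<lambda>x. x * x) = 1"
    unfolding std_normal_def
    using 2 by (simp_all add: integrable_real_density integral_real_density has_bochner_integral_iff)
qed

lemma PiM_std_normal_covariance:
  fixes i j :: nat
  assumes "i < p" "j < p"
  shows "integrable (PiM {..<p} (\<lambda>_. std_normal)) (\<lambda>z. z i * z j)"
    and "integral\<^sup>L (PiM {..<p} (\<lambda>_. std_normal)) (\<lambda>z. z i * z j) = (if i = j then 1 else 0)"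
proof -
  interpret S: prob_space std_normal by (rule prob_space_std_normal)
  interpret P: product_sigma_finite "\<lambda>_::nat. std_normal"
    by (simp add: product_sigma_finite_def S.sigma_finite_measure_axioms)
  \<comment> \<open>\<open>z i * z j\<close> is written with one factor per coordinate, so that one
    product formula serves \<open>i = j\<close> and \<open>i \<noteq> j\<close> alike. A factor has
    mean zero exactly when \<open>k\<close> equals one of \<open>i\<close>, \<open>j\<close> but not
    the other.\<close>
  define f :: "nat \<Rightarrow> real \<Rightarrow> real"
    where "f k x = (if k = i then x else 1) * (if k = j then x else 1)" for k x
  have f: "(\<Prod>k<p. f k (z k)) = z i * z j" for z
    using assms by (simp add: f_def prod.distrib)
  have "has_bochner_integral std_normal (f k) (if k = i \<longleftrightarrow> k = j then 1 else 0)" for k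
  proof -
    consider "k = i" "k = j" | "k = i" "k \<noteq> j" | "k \<noteq> i" "k = j" | "k \<noteq> i" "k \<noteq> j" by blast
    then show ?thesis
      using std_normal_moments S.prob_space unfolding f_def has_bochner_integral_iff by cases simp_all
  qed
  then have int: "integrable std_normal (f k)"
    and val: "integral\<^sup>L std_normal (f k) = (if k = i \<longleftrightarrow> k = j then 1 else 0)" for k
    by (simp_all add: has_bochner_integral_iff)
  show "integrable (PiM {..<p} (\<lambda>_. std_normal)) (\<lambda>z. z i * z j)"
    using P.product_integrable_prod[of "{..<p}" f] int by (simp add: f)
  have "integral\<^sup>L (PiM {..<p} (\<lambda>_. std_normal)) (\<lambda>z. z i * z j) = (\<Prod>k<p. integral\<^sup>L std_normal (f k))"
    using P.product_integral_prod[of "{..<p}" f] int by (simp add: f)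
  also have "\<dots> = (if i = j then 1 else 0)"
  proof (cases "i = j")
    case False
    then have "\<not> (i = i \<longleftrightarrow> i = j)" by simp
    then show ?thesis using assms False by (simp only: val prod_zero_iff finite_lessThan) auto
  qed (simp add: val)
  finally show "integral\<^sup>L (PiM {..<p} (\<lambda>_. std_normal)) (\<lambda>z. z i * z j) = (if i = j then 1 else 0)" .
qed

lemma gauss_law_covariance:
  assumes ex: "\<exists>B :: nat \<Rightarrow> nat \<Rightarrow> real. \<forall>a<p. \<forall>b<p. (\<Sum>j<p. B a j * B b j) = S a b"
    and ab: "a < p" "b < p"
  shows "integrable (gauss_law p S) (\<lambda>x. x a * x b)"
    and "integral\<^sup>L (gauss_law p S) (\<lambda>x. x a * x b) = S a b"
proof -
  obtain B where "\<forall>a<p. \<forall>b<p. (\<Sum>j<p. B a j * B b j) = S a b"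
    and law: "gauss_law p S = distr (PiM {..<p} (\<lambda>_. std_normal)) (vec_space p) (lin_map p B)"
    using gauss_law_factor[OF ex] .
  then have BB: "(\<Sum>j<p. B a j * B b j) = S a b" if "a < p" "b < p" for a b
    using that by blast
  let ?Z = "PiM {..<p} (\<lambda>_. std_normal)"
  have m: "(\<lambda>x. x a * x b) \<in> borel_measurable (vec_space p)" using ab by measurable
  have eq: "lin_map p B z a * lin_map p B z b = (\<Sum>i<p. \<Sum>j<p. B a i * B b j * (z i * z j))" for z
    using ab by (simp add: lin_map_def sum_product ac_simps)
  have "has_bochner_integral ?Z (\<lambda>z. B a i * B b j * (z i * z j)) (B a i * B b j * (if i = j then 1 else 0))"
    if "i < p" "j < p" for i j
    using PiM_std_normal_covariance[OF that]
    by (intro has_bochner_integral_mult_right) (simp add: has_bochner_integral_iff)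
  then have "has_bochner_integral ?Z (\<lambda>z. \<Sum>i<p. \<Sum>j<p. B a i * B b j * (z i * z j))
      (\<Sum>i<p. \<Sum>j<p. B a i * B b j * (if i = j then 1 else 0))"
    by (intro has_bochner_integral_sum) auto
  moreover have "(\<Sum>i<p. \<Sum>j<p. B a i * B b j * (if i = j then 1 else 0)) = S a b"
    using BB[OF ab] by (simp add: if_distrib cong: if_cong)
  ultimately have "has_bochner_integral ?Z (\<lambda>z. lin_map p B z a * lin_map p B z b) (S a b)"
    by (simp only: eq)
  then show "integrable (gauss_law p S) (\<lambda>x. x a * x b)"
    and "integral\<^sup>L (gauss_law p S) (\<lambda>x. x a * x b) = S a b"
    unfolding law integrable_distr_eq[OF measurable_lin_map_std_normal m]
      integral_distr[OF measurable_lin_map_std_normal m]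
    by (simp_all add: has_bochner_integral_iff)
qed

lemma sets_gauss_law[measurable_cong]: "sets (gauss_law p S) = sets (vec_space p)"
  by (simp add: gauss_law_def Let_def)

text \<open>Whichever matrix the choice operator yields, the law is the image of a probability
  measure under a measurable map.\<close>

lemma prob_space_gauss_law:
  "prob_space (gauss_law p S)"
proof -
  interpret prob_space "PiM {..<p} (\<lambda>_. std_normal)" by (rule prob_space_PiM_std_normal)
  show ?thesis
    unfolding gauss_law_def Let_def lin_map_def[symmetric]
    by (rule prob_space_distr[OF measurable_lin_map_std_normal])
qed

subsection \<open>Change of measure\<close>

text \<open>With \<open>D = ln (dQ/dP)\<close>, the mean of \<open>D\<close> is
  \<open>KL(Q, P)\<close> under \<open>Q\<close> and \<open>- KL(P, Q)\<close> under
  \<open>P\<close>. This is the Donsker-Varadhan inequality for \<open>s\<close> times the indicator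
  of \<open>E\<close>, weakened by adding the nonnegative \<open>KL(P, Q)\<close>.\<close>

lemma change_of_measure:
  assumes P: "prob_space P" and Q: "prob_space Q"
    and D[measurable]: "D \<in> borel_measurable P"
    and dens: "Q = density P (\<lambda>x. ennreal (exp (D x)))"
    and intP: "integrable P D" and intQ: "integrable Q D"
    and E[measurable]: "E \<in> sets P" and s: "0 \<le> s"
  shows "s * measure Q E \<le> integral\<^sup>L Q D - integral\<^sup>L P D + ln (1 + measure P E * (exp s - 1))"
proof -
  interpret P: prob_space P by fact
  interpret Q: prob_space Q by fact
  have [measurable_cong]: "sets Q = sets P" by (simp add: dens)
  define Z where "Z = 1 + measure P E * (exp s - 1)"
  have Z: "Z \<ge> 1" using s by (simp add: Z_def)
  define f where "f x = s * indicator E x" for x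
  have [measurable]: "f \<in> borel_measurable P" unfolding f_def by measurable
  have ef: "exp (f x) = 1 + indicator E x * (exp s - 1)" for x
    by (simp add: f_def indicator_def)
  have intE: "integrable P (indicator E :: _ \<Rightarrow> real)" "integrable Q (indicator E :: _ \<Rightarrow> real)"
    by (simp_all add: P.emeasure_eq_measure Q.emeasure_eq_measure)
  have f1: "has_bochner_integral P (\<lambda>x. exp (f x)) Z"
    unfolding ef using intE by (simp add: has_bochner_integral_iff Z_def P.prob_space)
  \<comment> \<open>The exponential of \<open>f - D - ln Z\<close> has mean one under
    \<open>Q\<close>: the factor \<open>exp D\<close> of the density cancels, and \<open>Z\<close>
    is the mean of \<open>exp f\<close> under \<open>P\<close>.\<close>
  have ed: "exp (D x) * (exp (f x - D x - ln Z)) = exp (f x) / Z" for x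
    using Z by (simp add: exp_diff)
  have h: "integrable Q (\<lambda>x. exp (f x - D x - ln Z))" "integral\<^sup>L Q (\<lambda>x. exp (f x - D x - ln Z)) = 1"
    using f1 Z unfolding dens
    by (simp_all add: integrable_real_density integral_real_density ed has_bochner_integral_iff)
  have f2: "integrable Q f" "integral\<^sup>L Q f = s * measure Q E"
    using intE unfolding f_def by simp_all
  \<comment> \<open>The inequality \<open>y \<le> exp y - 1\<close> is integrated at
    \<open>y = f - D - ln Z\<close>.\<close>
  have "integral\<^sup>L Q (\<lambda>x. f x - D x - ln Z) \<le> integral\<^sup>L Q (\<lambda>x. exp (f x - D x - ln Z) - 1)"
  proof (rule integral_mono)
    show "f x - D x - ln Z \<le> exp (f x - D x - ln Z) - 1" for x
      using exp_ge_add_one_self[of "f x - D x - ln Z"] by linarith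
  qed (use f2 h intQ in simp_all)
  then have 1: "s * measure Q E - integral\<^sup>L Q D - ln Z \<le> 0"
    using f2 h intQ by (simp add: Q.prob_space)
  have e: "integrable P (\<lambda>x. exp (D x))" "integral\<^sup>L P (\<lambda>x. exp (D x)) = 1"
  proof -
    have "integral\<^sup>L Q (\<lambda>x. 1 :: real) = integral\<^sup>L P (\<lambda>x. exp (D x) * 1)"
      unfolding dens by (rule integral_real_density) simp_all
    then show "integral\<^sup>L P (\<lambda>x. exp (D x)) = 1" by (simp add: Q.prob_space)
    have "integrable Q (\<lambda>x. 1 :: real)" by simp
    then show "integrable P (\<lambda>x. exp (D x))" unfolding dens by (simp add: integrable_real_density)
  qed
  \<comment> \<open>The same inequality at \<open>y = D\<close> shows that the mean of
    \<open>D\<close> under \<open>P\<close> is at most zero, so subtracting it only enlarges the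
    bound.\<close>
  have "integral\<^sup>L P D \<le> integral\<^sup>L P (\<lambda>x. exp (D x) - 1)"
  proof (rule integral_mono)
    show "D x \<le> exp (D x) - 1" for x using exp_ge_add_one_self[of "D x"] by linarith
  qed (use e intP in simp_all)
  then have "integral\<^sup>L P D \<le> 0" using e by (simp add: P.prob_space)
  with 1 show ?thesis by (simp add: Z_def)
qed

lemma PiM_component_integral:
  fixes D :: "'a \<Rightarrow> real"
  assumes P: "prob_space P" and i: "i \<in> I" and D[measurable]: "D \<in> borel_measurable P"
  shows "integrable (PiM I (\<lambda>_. P)) (\<lambda>x. D (x i)) \<longleftrightarrow> integrable P D"
    and "integral\<^sup>L (PiM I (\<lambda>_. P)) (\<lambda>x. D (x i)) = integral\<^sup>L P D"
proof -
  have d: "distr (PiM I (\<lambda>_. P)) P (\<lambda>x. x i) = P"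
    using distr_PiM_component[of I "\<lambda>_. P" i] P i by simp
  have m: "(\<lambda>x. x i) \<in> measurable (PiM I (\<lambda>_. P)) P" using i by measurable
  show "integrable (PiM I (\<lambda>_. P)) (\<lambda>x. D (x i)) \<longleftrightarrow> integrable P D"
    using integrable_distr_eq[OF m D] by (simp add: d)
  show "integral\<^sup>L (PiM I (\<lambda>_. P)) (\<lambda>x. D (x i)) = integral\<^sup>L P D"
    using integral_distr[OF m D] by (simp add: d)
qed

text \<open>The log-density of a product is the sum of the log-densities, so its means under both
  laws are \<open>n\<close> times those of one coordinate.\<close>

lemma change_of_measure_PiM:
  assumes P: "prob_space P" and Q: "prob_space Q"
    and D[measurable]: "D \<in> borel_measurable P"
    and dens: "Q = density P (\<lambda>x. ennreal (exp (D x)))"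
    and intP: "integrable P D" and intQ: "integrable Q D"
    and E: "E \<in> sets (PiM {..<n::nat} (\<lambda>_. P))" and s: "0 \<le> s"
  shows "s * measure (PiM {..<n} (\<lambda>_. Q)) E \<le> real n * (integral\<^sup>L Q D - integral\<^sup>L P D)
    + ln (1 + measure (PiM {..<n} (\<lambda>_. P)) E * (exp s - 1))"
proof -
  let ?P = "PiM {..<n} (\<lambda>_. P)" and ?Q = "PiM {..<n} (\<lambda>_. Q)"
  let ?D = "\<lambda>x. \<Sum>i<n. D (x i)"
  have DQ: "D \<in> borel_measurable Q" by (simp add: dens)
  have m: "?D \<in> borel_measurable ?P" by measurable
  have "?Q = density ?P (\<lambda>x. \<Prod>i<n. ennreal (exp (D (x i))))"
    unfolding dens using P Q
    by (intro PiM_density) (simp_all add: dens[symmetric] prob_space_imp_sigma_finite)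
  then have d: "?Q = density ?P (\<lambda>x. ennreal (exp (?D x)))"
    by (simp add: prod_ennreal exp_sum)
  have comp: "integrable ?P (\<lambda>x. D (x i))" "integral\<^sup>L ?P (\<lambda>x. D (x i)) = integral\<^sup>L P D"
    "integrable ?Q (\<lambda>x. D (x i))" "integral\<^sup>L ?Q (\<lambda>x. D (x i)) = integral\<^sup>L Q D" if "i < n" for i
    using that intP intQ PiM_component_integral[OF P _ D, of i "{..<n}"]
      PiM_component_integral[OF Q _ DQ, of i "{..<n}"] by simp_all
  have "s * measure ?Q E \<le> integral\<^sup>L ?Q ?D - integral\<^sup>L ?P ?D + ln (1 + measure ?P E * (exp s - 1))"
  proof (rule change_of_measure[OF _ _ m d _ _ E s])
    show "prob_space ?P" "prob_space ?Q" using P Q by (simp_all add: prob_space_PiM)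
    show "integrable ?P ?D" "integrable ?Q ?D"
      by (auto intro!: Bochner_Integration.integrable_sum simp: comp)
  qed
  moreover have "integral\<^sup>L ?P ?D = real n * integral\<^sup>L P D"
    by (subst Bochner_Integration.integral_sum) (simp_all add: comp)
  moreover have "integral\<^sup>L ?Q ?D = real n * integral\<^sup>L Q D"
    by (subst Bochner_Integration.integral_sum) (simp_all add: comp)
  ultimately show ?thesis by (simp add: right_diff_distrib)
qed

section \<open>Comparison of two Gaussian samples\<close>

lemma gauss_law_quad_integral:
  assumes ex: "\<exists>B :: nat \<Rightarrow> nat \<Rightarrow> real. \<forall>a<p. \<forall>b<p. (\<Sum>j<p. B a j * B b j) = S a b"
  shows "has_bochner_integral (gauss_law p S) (quad p W) (\<Sum>a<p. \<Sum>b<p. W a b * S a b)"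
proof -
  have "has_bochner_integral (gauss_law p S) (\<lambda>x. W a b * (x a * x b)) (W a b * S a b)"
    if "a < p" "b < p" for a b
    using gauss_law_covariance[OF ex that]
    by (intro has_bochner_integral_mult_right) (simp add: has_bochner_integral_iff)
  then have "has_bochner_integral (gauss_law p S) (\<lambda>x. \<Sum>a<p. \<Sum>b<p. W a b * (x a * x b))
      (\<Sum>a<p. \<Sum>b<p. W a b * S a b)"
    by (intro has_bochner_integral_sum) auto
  then show ?thesis by (simp add: quad_def[abs_def])
qed

text \<open>The first term on the right is \<open>n\<close> times the symmetrised Kullback-Leibler divergence, in which the
  normalising constants of the two densities cancel, so that no determinant is needed.\<close>
lemma gauss_sample_change_of_measure:
  assumes ex: "\<exists>B :: nat \<Rightarrow> nat \<Rightarrow> real. \<forall>a<p. \<forall>b<p. (\<Sum>j<p. B a j * B b j) = S a b"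
    and SW: "\<And>a b. a < p \<Longrightarrow> b < p \<Longrightarrow> (\<Sum>c<p. S a c * W c b) = (if a = b then 1 else 0)"
    and W: "\<And>a b. W a b = W b a"
    and ex': "\<exists>B :: nat \<Rightarrow> nat \<Rightarrow> real. \<forall>a<p. \<forall>b<p. (\<Sum>j<p. B a j * B b j) = S' a b"
    and SW': "\<And>a b. a < p \<Longrightarrow> b < p \<Longrightarrow> (\<Sum>c<p. S' a c * W' c b) = (if a = b then 1 else 0)"
    and W': "\<And>a b. W' a b = W' b a"
    and E: "E \<in> sets (sample_law n p S)" and s: "0 \<le> s"
  shows "s * measure (sample_law n p S') E
    \<le> real n / 2 * (\<Sum>a<p. \<Sum>b<p. (W a b - W' a b) * (S' a b - S a b))
      + ln (1 + measure (sample_law n p S) E * (exp s - 1))"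
proof -
  obtain c where c: "c > 0"
    and P: "gauss_law p S = density (vec_space p) (\<lambda>x. ennreal (c * exp (- quad p W x / 2)))"
    using gauss_law_density[OF ex SW W] .
  obtain c' where c': "c' > 0"
    and Q: "gauss_law p S' = density (vec_space p) (\<lambda>x. ennreal (c' * exp (- quad p W' x / 2)))"
    using gauss_law_density[OF ex' SW' W'] .
  \<comment> \<open>The log-likelihood ratio of one observation. Its constant
    \<open>ln (c' / c)\<close> has the same mean under both laws and drops out in
    \<open>diff\<close>.\<close>
  define D where "D x = ln (c' / c) + (quad p W x - quad p W' x) / 2" for x
  have [measurable]: "D \<in> borel_measurable (vec_space p)" unfolding D_def by measurable
  have prod: "c * exp (- quad p W x / 2) * exp (D x) = c' * exp (- quad p W' x / 2)" for x
  proof -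
    have "c * exp (- quad p W x / 2) * exp (D x)
        = c' * exp (- quad p W x / 2 + (quad p W x - quad p W' x) / 2)"
      using c c' by (simp only: D_def exp_add) simp
    also have "- quad p W x / 2 + (quad p W x - quad p W' x) / 2 = - quad p W' x / 2"
      by (simp add: field_simps)
    finally show ?thesis .
  qed
  have dens: "gauss_law p S' = density (gauss_law p S) (\<lambda>x. ennreal (exp (D x)))"
    unfolding P Q by (subst density_density_eq) (simp_all only: prod ennreal_mult''[symmetric] exp_ge_zero, measurable)
  have i: "has_bochner_integral (gauss_law p T) D
     (ln (c' / c) + ((\<Sum>a<p. \<Sum>b<p. W a b * T a b) - (\<Sum>a<p. \<Sum>b<p. W' a b * T a b)) / 2)"
    if "\<exists>B :: nat \<Rightarrow> nat \<Rightarrow> real. \<forall>a<p. \<forall>b<p. (\<Sum>j<p. B a j * B b j) = T a b" for T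
  proof -
    interpret prob_space "gauss_law p T" by (rule prob_space_gauss_law)
    show ?thesis
      using gauss_law_quad_integral[OF that, of W] gauss_law_quad_integral[OF that, of W']
      unfolding D_def by (simp add: has_bochner_integral_iff prob_space)
  qed
  have diff: "integral\<^sup>L (gauss_law p S') D - integral\<^sup>L (gauss_law p S) D
      = (\<Sum>a<p. \<Sum>b<p. (W a b - W' a b) * (S' a b - S a b)) / 2"
    using i[OF ex] i[OF ex']
    by (simp add: has_bochner_integral_iff sum_subtractf ring_distribs diff_divide_distrib add_divide_distrib)
  have "s * measure (sample_law n p S') E
      \<le> real n * (integral\<^sup>L (gauss_law p S') D - integral\<^sup>L (gauss_law p S) D)
        + ln (1 + measure (sample_law n p S) E * (exp s - 1))"
    unfolding sample_law_def
  proof (rule change_of_measure_PiM[OF prob_space_gauss_law prob_space_gauss_law _ dens _ _ _ s])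
    show "D \<in> borel_measurable (gauss_law p S)" by measurable
    show "integrable (gauss_law p S) D" "integrable (gauss_law p S') D"
      using i[OF ex] i[OF ex'] by (simp_all add: has_bochner_integral_iff)
    show "E \<in> sets (PiM {..<n} (\<lambda>_. gauss_law p S))" using E by (simp add: sample_law_def)
  qed
  then show ?thesis unfolding diff by simp
qed

subsection \<open>Balanced partitions and exchanges\<close>

text \<open>Partitions are handled through labellings, whose fibres are the groups: an exchange of
  two elements becomes composition with a transposition.\<close>

definition balanced_labelling :: "nat \<Rightarrow> nat \<Rightarrow> nat \<Rightarrow> (nat \<Rightarrow> nat) \<Rightarrow> bool" where
  "balanced_labelling p K m l \<longleftrightarrow> (\<forall>a<p. l a < K) \<and> (\<forall>k<K. card {a\<in>{..<p}. l a = k} = m)"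

definition label_partition :: "nat \<Rightarrow> nat \<Rightarrow> (nat \<Rightarrow> nat) \<Rightarrow> nat set set" where
  "label_partition p K l = (\<lambda>k. {a\<in>{..<p}. l a = k}) ` {..<K}"

text \<open>The entries of \<open>A_G A_G^t\<close>, the membership matrix \<open>M\<close>.\<close>

definition same_label :: "(nat \<Rightarrow> nat) \<Rightarrow> nat \<Rightarrow> nat \<Rightarrow> real" where
  "same_label l a b = (if l a = l b then 1 else 0)"

text \<open>Since \<open>m > 0\<close>, every fibre has an element, and a common element of two
  fibres carries both labels.\<close>

lemma balanced_labelling_inj:
  assumes "balanced_labelling p K m l" "m > 0"
  shows "inj_on (\<lambda>k. {a\<in>{..<p}. l a = k}) {..<K}"
proof (rule inj_onI)
  fix k k' assume "k \<in> {..<K}" "k' \<in> {..<K}" and eq: "{a\<in>{..<p}. l a = k} = {a\<in>{..<p}. l a = k'}"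
  then have "card {a\<in>{..<p}. l a = k} = m" using assms by (simp add: balanced_labelling_def)
  then have "{a\<in>{..<p}. l a = k} \<noteq> {}" using assms(2) by (metis card.empty less_irrefl)
  then obtain a where "a \<in> {a\<in>{..<p}. l a = k}" by blast
  moreover from this have "a \<in> {a\<in>{..<p}. l a = k'}" by (simp only: eq)
  ultimately show "k = k'" by simp
qed

lemma label_partition_balanced:
  assumes l: "balanced_labelling p K m l" and m: "m > 0"
  shows "label_partition p K l \<in> balanced_partitions p K m"
proof -
  have "{a\<in>{..<p}. l a = k} \<noteq> {}" if "k < K" for k
  proof -
    have "card {a\<in>{..<p}. l a = k} = m" using l that by (simp add: balanced_labelling_def)
    then show ?thesis using m by (metis card.empty less_irrefl)
  qed
  then have "partition_on {..<p} (label_partition p K l)"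
    using l by (intro partition_onI)
      (auto simp: label_partition_def balanced_labelling_def disjnt_def)
  moreover have "card (label_partition p K l) = K"
    unfolding label_partition_def using balanced_labelling_inj[OF l m] by (simp add: card_image)
  moreover have "\<forall>g\<in>label_partition p K l. card g = m"
    using l by (auto simp: label_partition_def balanced_labelling_def)
  ultimately show ?thesis by (simp add: balanced_partitions_def)
qed

text \<open>The left side depends on the partition alone, so equal partitions can be compared
  through different labellings.\<close>

lemma label_partition_same_group:
  assumes "balanced_labelling p K m l" "a < p" "b < p"
  shows "(\<exists>g\<in>label_partition p K l. a \<in> g \<and> b \<in> g) \<longleftrightarrow> l a = l b"
  using assms by (auto simp: label_partition_def balanced_labelling_def)

lemma Sigma_G_label_partition:
  assumes l: "balanced_labelling p K m l" and m: "m > 0" and ab: "a < p" "b < p"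
  shows "Sigma_G tau (label_partition p K l) a b = tau * same_label l a b + (if a = b then 1 else 0)"
proof -
  have "(\<Sum>g\<in>label_partition p K l. indicator g a * indicator g b)
      = (\<Sum>k<K. indicator {a\<in>{..<p}. l a = k} a * indicator {a\<in>{..<p}. l a = k} b :: real)"
    unfolding label_partition_def by (subst sum.reindex[OF balanced_labelling_inj[OF l m]]) simp
  also have "\<dots> = (\<Sum>k<K. if k = l a then same_label l a b else 0)"
    using ab by (intro sum.cong refl) (auto simp: same_label_def)
  also have "\<dots> = same_label l a b"
    using l ab by (simp add: balanced_labelling_def)
  finally show ?thesis by (simp add: Sigma_G_def)
qed

section \<open>Algebra of the membership matrix\<close>

lemma same_label_row_sum:
  assumes l: "balanced_labelling p K m l" and a: "a < p"
  shows "(\<Sum>b<p. same_label l a b) = real m"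
proof -
  have "(\<Sum>b<p. same_label l a b) = (\<Sum>b\<in>{b\<in>{..<p}. l b = l a}. 1)"
    unfolding same_label_def by (subst sum.inter_filter) (auto intro!: sum.cong)
  also have "\<dots> = real m" using l a by (simp add: balanced_labelling_def)
  finally show ?thesis .
qed

lemma same_label_square:
  assumes l: "balanced_labelling p K m l" and a: "a < p"
  shows "(\<Sum>c<p. same_label l a c * same_label l c b) = real m * same_label l a b"
proof -
  have "(\<Sum>c<p. same_label l a c * same_label l c b) = (\<Sum>c<p. same_label l a c) * same_label l a b"
    unfolding sum_distrib_right by (intro sum.cong refl) (simp add: same_label_def)
  then show ?thesis by (simp add: same_label_row_sum[OF l a])
qed

text \<open>Since \<open>M M = m M\<close>, the matrices \<open>x M + I\<close> are closed under
  multiplication. The square root and the inverse of the covariance thus reduce to scalar equations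
  in \<open>x\<close> and \<open>y\<close>.\<close>

lemma shifted_same_label_product:
  assumes l: "balanced_labelling p K m l" and a: "a < p" and b: "b < p"
  shows "(\<Sum>c<p. (x * same_label l a c + (if a = c then 1 else 0)) * (y * same_label l c b + (if c = b then 1 else 0)))
    = (x * y * real m + x + y) * same_label l a b + (if a = b then 1 else 0)"
proof -
  have "(\<Sum>c<p. (x * same_label l a c + (if a = c then 1 else 0)) * (y * same_label l c b + (if c = b then 1 else 0)))
    = (\<Sum>c<p. x * y * (same_label l a c * same_label l c b) + (if b = c then x * same_label l a c else 0)
        + (if a = c then y * same_label l c b + (if c = b then 1 else 0) else 0))"
    by (intro sum.cong refl) (auto simp: algebra_simps)
  also have "\<dots> = x * y * (\<Sum>c<p. same_label l a c * same_label l c b) + x * same_label l a b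
      + (y * same_label l a b + (if a = b then 1 else 0))"
    using a b by (simp add: sum.distrib sum_distrib_left)
  also have "\<dots> = (x * y * real m + x + y) * same_label l a b + (if a = b then 1 else 0)"
    by (simp only: same_label_square[OF l a]) (simp add: algebra_simps)
  finally show ?thesis .
qed

lemma Sigma_G_factor:
  assumes l: "balanced_labelling p K m l" and m: "m > 0" and tau: "tau > 0"
  shows "\<exists>B :: nat \<Rightarrow> nat \<Rightarrow> real. \<forall>a<p. \<forall>b<p.
    (\<Sum>j<p. B a j * B b j) = Sigma_G tau (label_partition p K l) a b"
proof -
  \<comment> \<open>A root of \<open>m beta^2 + 2 beta = tau\<close>, which makes
    \<open>beta M + I\<close> a symmetric square root of the covariance.\<close>
  define beta where "beta = (sqrt (1 + m * tau) - 1) / m"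
  have "real m * beta + 1 = sqrt (1 + m * tau)" using m by (simp add: beta_def)
  then have "(real m * beta + 1)\<^sup>2 = 1 + m * tau" using tau by simp
  then have "real m * (beta * beta * m + beta + beta) = real m * tau"
    by (simp add: power2_eq_square algebra_simps)
  then have beta: "beta * beta * m + beta + beta = tau" using m by simp
  show ?thesis
  proof (intro exI allI impI)
    fix a b assume ab: "a < p" "b < p"
    have "(\<Sum>j<p. (beta * same_label l a j + (if a = j then 1 else 0)) * (beta * same_label l b j + (if b = j then 1 else 0)))
      = (\<Sum>j<p. (beta * same_label l a j + (if a = j then 1 else 0)) * (beta * same_label l j b + (if j = b then 1 else 0)))"
      by (intro sum.cong refl) (auto simp: same_label_def)
    also have "\<dots> = Sigma_G tau (label_partition p K l) a b"
      by (simp only: shifted_same_label_product[OF l ab] beta Sigma_G_label_partition[OF l m ab])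
    finally show "(\<Sum>j<p. (beta * same_label l a j + (if a = j then 1 else 0)) * (beta * same_label l b j + (if b = j then 1 else 0)))
      = Sigma_G tau (label_partition p K l) a b" .
  qed
qed

text \<open>The inverse of the covariance \<open>tau M + I\<close>: the coefficient \<open>y\<close>
  of \<open>M\<close> solves \<open>tau y m + tau + y = 0\<close>.\<close>

definition precision :: "real \<Rightarrow> nat \<Rightarrow> (nat \<Rightarrow> nat) \<Rightarrow> nat \<Rightarrow> nat \<Rightarrow> real" where
  "precision tau m l a b = - (tau / (1 + real m * tau)) * same_label l a b + (if a = b then 1 else 0)"

lemma precision_sym: "precision tau m l a b = precision tau m l b a"
  by (auto simp: precision_def same_label_def)

lemma Sigma_G_precision:
  assumes l: "balanced_labelling p K m l" and m: "m > 0" and tau: "tau > 0"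
    and ab: "a < p" "b < p"
  shows "(\<Sum>c<p. Sigma_G tau (label_partition p K l) a c * precision tau m l c b) = (if a = b then 1 else 0)"
proof -
  have "1 + real m * tau \<noteq> 0" using tau by (smt (verit) mult_nonneg_nonneg of_nat_0_le_iff)
  then have z: "tau * - (tau / (1 + real m * tau)) * real m + tau + - (tau / (1 + real m * tau)) = 0"
    by (simp add: field_simps)
  have "(\<Sum>c<p. Sigma_G tau (label_partition p K l) a c * precision tau m l c b)
      = (\<Sum>c<p. (tau * same_label l a c + (if a = c then 1 else 0)) *
          (- (tau / (1 + real m * tau)) * same_label l c b + (if c = b then 1 else 0)))"
    using ab by (intro sum.cong refl) (simp add: Sigma_G_label_partition[OF l m] precision_def)
  also have "\<dots> = (if a = b then 1 else 0)"
    by (simp only: shifted_same_label_product[OF l ab] z)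
  finally show ?thesis .
qed

section \<open>Exchanges of \<open>0\<close> with another element\<close>

definition swap0 :: "nat \<Rightarrow> nat \<Rightarrow> nat" where
  "swap0 b a = (if a = 0 then b else if a = b then 0 else a)"

text \<open>\<open>swap0 b\<close> is an involution of \<open>{..<p}\<close>, so it matches the
  fibres of the two labellings one to one.\<close>

lemma balanced_labelling_swap0:
  assumes l: "balanced_labelling p K m l" and b: "b < p"
  shows "balanced_labelling p K m (l \<circ> swap0 b)"
proof -
  have "card {a\<in>{..<p}. (l \<circ> swap0 b) a = k} = m" if k: "k < K" for k
  proof -
    have "bij_betw (swap0 b) {a\<in>{..<p}. (l \<circ> swap0 b) a = k} {a\<in>{..<p}. l a = k}"
      using b by (intro bij_betwI[where g = "swap0 b"]) (auto simp: swap0_def)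
    then show ?thesis using l k by (auto dest!: bij_betw_same_card simp: balanced_labelling_def)
  qed
  then show ?thesis using l b by (auto simp: balanced_labelling_def swap0_def)
qed

text \<open>The reference partition, into consecutive intervals of length \<open>m\<close>. The
  elements outside the group of \<open>0\<close> are those of \<open>{m..<m * K}\<close>.\<close>

lemma balanced_labelling_div:
  assumes m: "m > 0"
  shows "balanced_labelling (m * K) K m (\<lambda>a. a div m)"
proof -
  have "{a\<in>{..<m * K}. a div m = k} = {k * m..<k * m + m}" if "k < K" for k
  proof -
    have "Suc k * m \<le> K * m" using that by (intro mult_le_mono1) simp
    then have "k * m + m \<le> m * K" by (simp add: mult.commute)
    then show ?thesis using m
      by (auto simp: div_nat_eqI mult.commute dividend_less_times_div add.commute)
  qed
  then show ?thesis using m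
    by (auto simp: balanced_labelling_def less_mult_imp_div_less mult.commute)
qed

text \<open>As \<open>m \<ge> 2\<close>, the element \<open>1\<close> keeps label \<open>0\<close>
  under every exchange considered. After the exchange with \<open>b\<close>, the only element of
  \<open>{m..<m * K}\<close> labelled \<open>0\<close> is \<open>b\<close>, so the companion of
  \<open>1\<close> in that range identifies \<open>b\<close>.\<close>

lemma label_partition_swap0_inj:
  assumes m: "m \<ge> 2"
  shows "inj_on (\<lambda>b. label_partition (m * K) K ((\<lambda>a. a div m) \<circ> swap0 b)) {m..<m * K}"
proof (rule inj_onI)
  fix b b' assume b: "b \<in> {m..<m * K}" and b': "b' \<in> {m..<m * K}"
    and eq: "label_partition (m * K) K ((\<lambda>a. a div m) \<circ> swap0 b)
      = label_partition (m * K) K ((\<lambda>a. a div m) \<circ> swap0 b')"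
  have bal: "balanced_labelling (m * K) K m ((\<lambda>a. a div m) \<circ> swap0 c)" if "c \<in> {m..<m * K}" for c
    using balanced_labelling_swap0[OF balanced_labelling_div] m that by simp
  have 1: "1 < m * K" using b m by simp
  have "b < m * K" using b by simp
  note same = label_partition_same_group[OF bal 1 this]
  have "((\<lambda>a. a div m) \<circ> swap0 b) 1 = ((\<lambda>a. a div m) \<circ> swap0 b) b"
    using b m by (simp add: swap0_def)
  then have "((\<lambda>a. a div m) \<circ> swap0 b') 1 = ((\<lambda>a. a div m) \<circ> swap0 b') b"
    using same[OF b] same[OF b'] eq by simp
  then show "b = b'" using b b' m by (auto simp: swap0_def div_eq_0_iff split: if_splits)
qed

text \<open>Entries change only in rows and columns \<open>0\<close> and \<open>b\<close>, and the
  squared difference of two 0-1 entries is at most their sum. Each row or column of the summed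
  matrix has total \<open>2 m\<close>, and four of them are counted.\<close>

lemma same_label_swap0_distance:
  assumes l: "balanced_labelling p K m l" and b: "0 < b" "b < p"
  shows "(\<Sum>a<p. \<Sum>c<p. (same_label (l \<circ> swap0 b) a c - same_label l a c)\<^sup>2) \<le> 8 * real m"
proof -
  note l' = balanced_labelling_swap0[OF l b(2)]
  define M where "M a c = same_label (l \<circ> swap0 b) a c + same_label l a c" for a c
  have row: "(\<Sum>c<p. M a c) = 2 * real m" if "a < p" for a
    using that by (simp add: M_def sum.distrib same_label_row_sum[OF l] same_label_row_sum[OF l'])
  have sym: "M a c = M c a" for a c by (simp add: M_def same_label_def eq_commute)
  have "(\<Sum>a<p. \<Sum>c<p. (same_label (l \<circ> swap0 b) a c - same_label l a c)\<^sup>2)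
      \<le> (\<Sum>a<p. \<Sum>c<p. indicator {0, b} a * M a c + indicator {0, b} c * M a c)"
    by (intro sum_mono) (auto simp: M_def same_label_def swap0_def indicator_def)
  also have "\<dots> = (\<Sum>a<p. \<Sum>c<p. indicator {0, b} a * M a c) + (\<Sum>a<p. \<Sum>c<p. indicator {0, b} c * M a c)"
    by (simp add: sum.distrib)
  also have "(\<Sum>a<p. \<Sum>c<p. indicator {0, b} c * M a c) = (\<Sum>c<p. \<Sum>a<p. indicator {0, b} c * M c a)"
    by (subst sum.swap) (simp add: sym)
  also have "(\<Sum>a<p. \<Sum>c<p. indicator {0, b} a * M a c) = (\<Sum>a<p. indicator {0, b} a * (2 * real m))"
    by (simp add: row flip: sum_distrib_left)
  also have "\<dots> = 4 * real m"
  proof -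
    have "(\<Sum>a<p. indicator {0, b} a) = (2::real)"
    proof -
      have "(\<Sum>a<p. indicator {0, b} a) = (\<Sum>a\<in>{0, b}. 1 :: real)"
        using b by (intro sum.mono_neutral_cong_right) auto
      then show ?thesis using b by simp
    qed
    then show ?thesis by (simp flip: sum_distrib_right)
  qed
  finally show ?thesis by linarith
qed

text \<open>The difference of covariances is \<open>tau (M' - M)\<close>, and that of precisions,
  taken in the opposite order, is \<open>tau / (1 + m tau)\<close> times \<open>M' - M\<close>. The
  divergence term is therefore a multiple of the squared distance bounded by
  \<open>8 m\<close>.\<close>

lemma swap_change_of_measure:
  assumes l: "balanced_labelling p K m l" and m: "m > 0" and tau: "tau > 0" and b: "0 < b" "b < p"
    and E: "E \<in> sets (sample_law n p (Sigma_G tau (label_partition p K l)))" and s: "0 \<le> s"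
  shows "s * measure (sample_law n p (Sigma_G tau (label_partition p K (l \<circ> swap0 b)))) E
    \<le> 4 * real n * real m * tau\<^sup>2 / (1 + real m * tau)
      + ln (1 + measure (sample_law n p (Sigma_G tau (label_partition p K l))) E * (exp s - 1))"
proof -
  note l' = balanced_labelling_swap0[OF l b(2)]
  let ?S = "Sigma_G tau (label_partition p K l)" and ?S' = "Sigma_G tau (label_partition p K (l \<circ> swap0 b))"
  let ?d = "\<Sum>a<p. \<Sum>c<p. (same_label (l \<circ> swap0 b) a c - same_label l a c)\<^sup>2"
  have pos: "1 + real m * tau > 0" using tau by (simp add: add_pos_nonneg)
  have "(\<Sum>a<p. \<Sum>c<p. (precision tau m l a c - precision tau m (l \<circ> swap0 b) a c) * (?S' a c - ?S a c))
      = (\<Sum>a<p. \<Sum>c<p. tau\<^sup>2 / (1 + real m * tau) * (same_label (l \<circ> swap0 b) a c - same_label l a c)\<^sup>2)"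
  proof (intro sum.cong refl)
    fix a c assume ac: "a \<in> {..<p}" "c \<in> {..<p}"
    let ?x = "same_label l a c" and ?y = "same_label (l \<circ> swap0 b) a c" and ?t = "tau / (1 + real m * tau)"
    have 1: "?S' a c - ?S a c = tau * (?y - ?x)"
      using ac by (simp add: Sigma_G_label_partition[OF l m] Sigma_G_label_partition[OF l' m] algebra_simps)
    have 2: "precision tau m l a c - precision tau m (l \<circ> swap0 b) a c = ?t * (?y - ?x)"
      unfolding precision_def by (simp add: right_diff_distrib)
    show "(precision tau m l a c - precision tau m (l \<circ> swap0 b) a c) * (?S' a c - ?S a c)
        = tau\<^sup>2 / (1 + real m * tau) * (?y - ?x)\<^sup>2"
      unfolding 1 2 by (simp add: power2_eq_square)
  qed
  also have "\<dots> = tau\<^sup>2 / (1 + real m * tau) * ?d" by (simp add: sum_distrib_left)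
  also have "\<dots> \<le> tau\<^sup>2 / (1 + real m * tau) * (8 * real m)"
    using pos by (intro mult_left_mono same_label_swap0_distance[OF l b]) simp
  finally have "real n / 2 * (\<Sum>a<p. \<Sum>c<p. (precision tau m l a c - precision tau m (l \<circ> swap0 b) a c) * (?S' a c - ?S a c))
      \<le> real n / 2 * (tau\<^sup>2 / (1 + real m * tau) * (8 * real m))"
    by (intro mult_left_mono) auto
  also have "\<dots> = 4 * real n * real m * tau\<^sup>2 / (1 + real m * tau)" by simp
  finally show ?thesis
    using gauss_sample_change_of_measure[OF
      Sigma_G_factor[OF l m tau] Sigma_G_precision[OF l m tau] precision_sym
      Sigma_G_factor[OF l' m tau] Sigma_G_precision[OF l' m tau] precision_sym E s]
    by linarith
qed

section \<open>Numerical bounds and the contradiction\<close>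

text \<open>If the square root attains the maximum, the denominator is bounded below by
  \<open>1\<close> and \<open>m \<le> 2 (m - 1)\<close> is used. Otherwise the denominator is
  bounded below by \<open>m tau\<close>, which leaves \<open>4 n tau\<close>; there
  \<open>100 tau \<le> L / n\<close> gives exactly \<open>L / 25\<close>.\<close>

lemma divergence_bound:
  fixes tau L :: real
  assumes n: "n \<ge> 1" and m: "m \<ge> 2" and tau: "tau > 0" and L: "L \<ge> 0"
    and le: "2 * tau \<le> 1 / 50 * max (sqrt (L / (real n * (real m - 1)))) (L / real n)"
  shows "4 * real n * real m * tau\<^sup>2 / (1 + real m * tau) \<le> L / 25"
proof -
  have m1: "real m - 1 \<ge> 1" and n0: "real n > 0" using n m by auto
  have pos: "1 + real m * tau \<ge> 1" using tau by simp
  consider "100 * tau \<le> sqrt (L / (real n * (real m - 1)))" | "100 * tau \<le> L / real n"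
    using le by (auto simp: max_def split: if_splits)
  then show ?thesis
  proof cases
    case 1
    then have "(100 * tau)\<^sup>2 \<le> (sqrt (L / (real n * (real m - 1))))\<^sup>2"
      using tau by (intro power_mono) auto
    also have "\<dots> = L / (real n * (real m - 1))" using L n0 m1 by simp
    finally have "10000 * tau\<^sup>2 * (real n * (real m - 1)) \<le> L"
      using n0 m1 by (simp add: power_mult_distrib pos_le_divide_eq)
    moreover have "real m * (real n * tau\<^sup>2) \<le> 2 * (real m - 1) * (real n * tau\<^sup>2)"
      using m1 n0 by (intro mult_right_mono) auto
    ultimately have "4 * real n * real m * tau\<^sup>2 \<le> L / 25"
      using L by (simp add: algebra_simps)
    moreover have "4 * real n * real m * tau\<^sup>2 / (1 + real m * tau) \<le> 4 * real n * real m * tau\<^sup>2 / 1"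
      using pos n0 by (intro divide_left_mono) auto
    ultimately show ?thesis by simp
  next
    case 2
    then have "100 * tau * real n \<le> L" using n0 by (simp add: pos_le_divide_eq)
    then have "4 * real n * tau \<le> L / 25" by (simp add: ac_simps)
    moreover have "4 * real n * real m * tau\<^sup>2 / (1 + real m * tau) \<le> 4 * real n * tau"
    proof -
      have "4 * real n * real m * tau\<^sup>2 \<le> 4 * real n * tau * (1 + real m * tau)"
        using n0 tau by (simp add: power2_eq_square algebra_simps)
      then show ?thesis using pos by (simp add: pos_divide_le_eq)
    qed
    ultimately show ?thesis by linarith
  qed
qed

text \<open>The probabilities of disjoint events sum to at most one, so they cannot all exceed the
  average \<open>1 / card I\<close>.\<close>

lemma exists_small_probability:
  assumes P: "prob_space P" and I: "finite I" "I \<noteq> {}"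
    and E: "\<And>i. i \<in> I \<Longrightarrow> E i \<in> sets P" and disj: "disjoint_family_on E I"
  obtains i where "i \<in> I" "measure P (E i) \<le> 1 / card I"
proof -
  interpret prob_space P by fact
  have sum: "(\<Sum>i\<in>I. measure P (E i)) \<le> 1"
    using finite_measure_finite_Union[OF I(1) _ disj] E by (metis image_subsetI prob_le_1)
  show ?thesis
  proof (rule ccontr)
    assume "\<not> thesis"
    then have "\<And>i. i \<in> I \<Longrightarrow> 1 / card I < measure P (E i)" using that by force
    then have "(\<Sum>i\<in>I. 1 / card I) < (\<Sum>i\<in>I. measure P (E i))"
      using I by (intro sum_strict_mono) auto
    then show False using sum I by simp
  qed
qed

text \<open>All sample laws share one sigma-algebra, so an event defined by an estimator is
  measurable for each of them.\<close>

lemma sets_sample_law: "sets (sample_law n p S) = sets (PiM {..<n} (\<lambda>_. vec_space p))"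
  unfolding sample_law_def by (intro sets_PiM_cong) (auto simp: sets_gauss_law)

lemma prob_space_sample_law: "prob_space (sample_law n p S)"
  unfolding sample_law_def by (intro prob_space_PiM prob_space_gauss_law)

text \<open>With \<open>exp s = p\<close> and \<open>r \<le> 2 / p\<close> the logarithmic term is
  at most \<open>ln 3\<close>, hence at most \<open>4 s / 5\<close>. The margin is
  \<open>1/25 + 4/5 = 21/25 < 6/7\<close>.\<close>

lemma information_numeric:
  fixes s q r :: real
  assumes p: "p \<ge> 4" and s: "s = ln (real p)" and r: "r \<le> 2 / real p" "0 \<le> r"
    and le: "s * q \<le> s / 25 + ln (1 + r * (exp s - 1))"
  shows "q \<le> 6 / 7"
proof -
  \<comment> \<open>\<open>3^5 = 243\<close> is below \<open>4^4 = 256\<close>, and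
    \<open>p \<ge> 4\<close>.\<close>
  have "5 * ln 3 = ln ((3::real) ^ 5)" by (subst ln_realpow) auto
  also have "\<dots> \<le> ln ((4::real) ^ 4)" by (subst ln_le_cancel_iff) auto
  also have "\<dots> = 4 * ln 4" by (subst ln_realpow) auto
  also have "\<dots> \<le> 4 * s" using p s by simp
  finally have l3: "5 * ln 3 \<le> 4 * s" .
  have s0: "s > 0" using p s by simp
  have "r * (exp s - 1) \<le> 2 / real p * (real p - 1)"
    using r p s by (intro mult_mono) auto
  also have "\<dots> \<le> 2" using p by (simp add: field_simps)
  finally have "ln (1 + r * (exp s - 1)) \<le> ln 3"
    using r s0 by (subst ln_le_cancel_iff) (auto intro: add_pos_nonneg)
  then have "s * q \<le> s * (6 / 7)" using le l3 s0 by linarith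
  then show ?thesis using s0 by simp
qed

theorem mainTheorem14:
  shows "\<exists>c::real. c > 0 \<and>
    (\<forall>(K::nat) (m::nat) (n::nat) (tau::real).
       K \<ge> 2 \<longrightarrow> m \<ge> 2 \<longrightarrow> n \<ge> 1 \<longrightarrow> tau > 0 \<longrightarrow>
       2 * tau \<le> c * max (sqrt (ln (real (m * K)) / (real n * (real m - 1))))
                          (ln (real (m * K)) / real n) \<longrightarrow>
       (\<forall>Gh\<in>estimators n (m * K).
          (SUP G\<in>balanced_partitions (m * K) K m.
             measure (sample_law n (m * K) (Sigma_G tau G))
               {x \<in> space (sample_law n (m * K) (Sigma_G tau G)). Gh x \<noteq> G}) \<ge> 1 / 7))"
proof (intro exI conjI allI impI ballI)
  \<comment> \<open>The constant of \<open>divergence_bound\<close>, which holds the divergence term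
    to \<open>ln p / 25\<close>.\<close>
  show "(1 / 50 :: real) > 0" by simp
  fix K m n :: nat and tau :: real and Gh
  assume K: "K \<ge> 2" and m: "m \<ge> 2" and n: "n \<ge> 1" and tau: "tau > 0"
    and le: "2 * tau \<le> 1 / 50 * max (sqrt (ln (real (m * K)) / (real n * (real m - 1))))
                          (ln (real (m * K)) / real n)"
    and "Gh \<in> estimators n (m * K)"
  then have Gh: "Gh \<in> measurable (PiM {..<n} (\<lambda>_. vec_space (m * K))) (count_space UNIV)"
    by (simp add: estimators_def)
  define p where "p = m * K"
  define l where "l a = a div m" for a
  define G where "G b = label_partition p K (l \<circ> swap0 b)" for b
  define G0 where "G0 = label_partition p K l"
  define P where "P H = sample_law n p (Sigma_G tau H)" for H
  define \<Omega> where "\<Omega> = space (PiM {..<n} (\<lambda>_. vec_space p))"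
  define E where "E b = {x\<in>\<Omega>. Gh x = G b}" for b
  have m0: "m > 0" using m by simp
  have "2 * 2 \<le> m * K" using m K by (rule mult_le_mono)
  then have p4: "p \<ge> 4" by (simp add: p_def)
  have "m * 2 \<le> m * K" using K by simp
  then have p2: "2 * m \<le> p" by (simp add: p_def)
  have l: "balanced_labelling p K m l"
    unfolding p_def l_def using balanced_labelling_div[OF m0] .
  have space: "space (P H) = \<Omega>" for H
    unfolding P_def \<Omega>_def by (rule sets_eq_imp_space_eq[OF sets_sample_law])
  have sets: "E b \<in> sets (P H)" for b H
  proof -
    have "E b = Gh -` {G b} \<inter> \<Omega>" by (auto simp: E_def)
    then show ?thesis
      using measurable_sets[OF Gh, of "{G b}"] by (simp add: P_def sets_sample_law \<Omega>_def p_def)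
  qed
  have prob: "prob_space (P H)" for H unfolding P_def by (rule prob_space_sample_law)
  show "(SUP G\<in>balanced_partitions (m * K) K m.
      measure (sample_law n (m * K) (Sigma_G tau G))
        {x \<in> space (sample_law n (m * K) (Sigma_G tau G)). Gh x \<noteq> G}) \<ge> 1 / 7"
  proof (rule ccontr)
    let ?err = "\<lambda>H. measure (P H) {x\<in>space (P H). Gh x \<noteq> H}"
    assume "\<not> ?thesis"
    then have less: "(SUP H\<in>balanced_partitions p K m. ?err H) < 1 / 7" by (simp add: P_def p_def)
    \<comment> \<open>The supremum of a set of reals bounds its members only if the set is bounded
      above.\<close>
    have "bdd_above (?err ` balanced_partitions p K m)"
      using prob_space.prob_le_1[OF prob] by (intro bdd_aboveI2[where M = 1]) auto
    then have "?err H < 1 / 7" if "H \<in> balanced_partitions p K m" for H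
      using cSUP_upper[OF that, of ?err] less by simp
    moreover have "G b \<in> balanced_partitions p K m" if "b < p" for b
      unfolding G_def using balanced_labelling_swap0[OF l that] m0 by (rule label_partition_balanced)
    ultimately have err: "?err (G b) < 1 / 7" if "b < p" for b using that by simp
    \<comment> \<open>Distinct exchanges give distinct partitions, and the estimator takes one value
      at a time, so the events \<open>E b\<close> are disjoint.\<close>
    have "inj_on G {m..<p}"
      unfolding G_def l_def p_def using label_partition_swap0_inj[OF m] .
    then have "disjoint_family_on E {m..<p}"
      by (auto simp: disjoint_family_on_def E_def inj_on_def)
    then obtain b where b: "b \<in> {m..<p}" and small: "measure (P G0) (E b) \<le> 1 / card {m..<p}"
      using p2 m0 by (elim exists_small_probability[OF prob _ _ sets, rotated 2]) auto
    \<comment> \<open>From \<open>K \<ge> 2\<close>: at least half of the elements lie outside the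
      group of \<open>0\<close>.\<close>
    have "real p \<le> 2 * real (p - m)" using p2 by simp
    then have "1 / card {m..<p} \<le> 2 / real p"
      using p4 p2 m0 by (simp add: divide_simps)
    with small have r: "measure (P G0) (E b) \<le> 2 / real p" by linarith
    \<comment> \<open>The tilt for which \<open>exp s = p\<close> offsets the reference probability
      \<open>2 / p\<close> while the left side gains a factor \<open>ln p\<close>.\<close>
    define s where "s = ln (real p)"
    have s: "s \<ge> 0" using p4 by (simp add: s_def)
    have "s * measure (P (G b)) (E b)
        \<le> 4 * real n * real m * tau\<^sup>2 / (1 + real m * tau) + ln (1 + measure (P G0) (E b) * (exp s - 1))"
      unfolding P_def G_def G0_def using b m0 sets[of b G0]
      by (intro swap_change_of_measure[OF l m0 tau _ _ _ s]) (simp_all add: P_def G0_def)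
    also have "4 * real n * real m * tau\<^sup>2 / (1 + real m * tau) \<le> s / 25"
      using le s by (intro divergence_bound[OF n m tau]) (simp_all add: s_def p_def)
    finally have "measure (P (G b)) (E b) \<le> 6 / 7"
      using r by (intro information_numeric[OF p4 s_def]) auto
    \<comment> \<open>The error event under \<open>P (G b)\<close> is the complement of
      \<open>E b\<close>, so an error below \<open>1/7\<close> contradicts the bound
      \<open>6/7\<close>.\<close>
    moreover have "{x\<in>space (P (G b)). Gh x \<noteq> G b} = space (P (G b)) - E b"
      by (auto simp: E_def space)
    then have "?err (G b) = 1 - measure (P (G b)) (E b)"
      using prob_space.prob_compl[OF prob sets] by simp
    ultimately show False using err[of b] b by simp
  qed
qed

end
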